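(* For every integer $n\ge 0$, $$\beta_{n,\lambda}=\sum_{k=0}^{n}\frac{(-1)^{k}}{k+1}\,k!\,S_{2,\lambda}(n,k)=\sum_{k=0}^{n}\frac{1}{k+1}\sum_{j=0}^{k}\binom{k}{j}(-1)^{j}(j)_{n,\lambda}.$$
   Context: Let $\lambda\in\mathbb{R}$. The degenerate falling factorial is $(x)_{0,\lambda}=1$, $(x)_{n,\lambda}=x(x-\lambda)\cdots(x-(n-1)\lambda)$ for $n\ge1$; the ordinary falling factorial is $(x)_0=1$, $(x)_n=x(x-1)\cdots(x-n+1)$. The degenerate exponential is the formal power series $e_\lambda^x(t)=\sum_{k\ge0}(x)_{k,\lambda}t^k/k!$ and $e_\lambda(t)=e_\lambda^1(t)$. The fully degenerate Bernoulli polynomials $\beta_{n,\lambda}(x)$ are defined by $\frac{\log(1+\lambda t)}{\lambda(e_\lambda(t)-1)}e_\lambda^x(t)=\sum_{n\ge0}\beta_{n,\lambda}(x)\frac{t^n}{n!}$ (for $\lambda=0$ interpret $\log(1+\lambda t)/\lambda$ as $t$ and $e_0^x(t)=e^{xt}$), and $\beta_{n,\lambda}=\beta_{n,\lambda}(0)$ are the fully degenerate Bernoulli numbers. The degenerate Stirling numbers of the second kind $S_{2,\lambda}(n,k)$ are defined by $(x)_{n,\lambda}=\sum_{k=0}^{n}S_{2,\lambda}(n,k)(x)_k$ for $n\ge0$; equivalently $\frac{1}{k!}(e_\lambda(t)-1)^k=\sum_{n\ge k}S_{2,\lambda}(n,k)\frac{t^n}{n!}$. *)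

theory Defs
  imports Complex_Main "HOL-Computational_Algebra.Formal_Power_Series"
begin

definition falling_fact :: "real \<Rightarrow> nat \<Rightarrow> real" where
  "falling_fact x n = (\<Prod>i<n. x - real i)"

definition deg_falling_fact :: "real \<Rightarrow> real \<Rightarrow> nat \<Rightarrow> real" where
  "deg_falling_fact lam x n = (\<Prod>i<n. x - real i * lam)"

definition deg_exp :: "real \<Rightarrow> real \<Rightarrow> real fps" where
  "deg_exp lam x = Abs_fps (\<lambda>k. deg_falling_fact lam x k / fact k)"

text \<open>The series \<open>log (1 + lam t) / lam\<close>, read as \<open>t\<close> when \<open>lam = 0\<close>; note that
  \<open>fps_ln 1\<close> is the series of \<open>log (1 + t)\<close>.\<close>

definition deg_log :: "real \<Rightarrow> real fps" where
  "deg_log lam = (if lam = 0 then fps_X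
     else fps_const (1 / lam) * fps_compose (fps_ln 1) (fps_const lam * fps_X))"

text \<open>Numerator and denominator of the quotient below both have zero constant term, and the
  denominator has subdegree 1, so the division of power series is exact
  (see \<open>deg_log_divide_exact\<close>).\<close>

definition full_deg_bernoulli_poly :: "real \<Rightarrow> nat \<Rightarrow> real \<Rightarrow> real" where
  "full_deg_bernoulli_poly lam n x =
     fact n * fps_nth (deg_log lam / (deg_exp lam 1 - 1) * deg_exp lam x) n"

definition full_deg_bernoulli :: "real \<Rightarrow> nat \<Rightarrow> real" where
  "full_deg_bernoulli lam n = full_deg_bernoulli_poly lam n 0"

text \<open>The defining identity fixes \<open>S n k\<close> for \<open>k \<le> n\<close> only; the remaining values are set to 0.
  Existence and uniqueness are shown in \<open>deg_stirling2_ex1\<close>.\<close>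

definition deg_stirling2 :: "real \<Rightarrow> nat \<Rightarrow> nat \<Rightarrow> real" where
  "deg_stirling2 lam = (THE S. (\<forall>n k. k > n \<longrightarrow> S n k = 0) \<and>
     (\<forall>n x. deg_falling_fact lam x n = (\<Sum>k=0..n. S n k * falling_fact x k)))"

lemma deg_exp_0: "deg_exp 0 x = fps_exp x"
  by (simp add: deg_exp_def deg_falling_fact_def fps_eq_iff)

lemma deg_log_divide_exact:
  "deg_log lam / (deg_exp lam 1 - 1) * (deg_exp lam 1 - 1) = deg_log lam"
proof -
  let ?g = "deg_exp lam 1 - 1"
  have g: "fps_nth ?g 0 = 0" "fps_nth ?g 1 = 1"
    by (simp_all add: deg_exp_def deg_falling_fact_def)
  have g0: "?g \<noteq> 0"
    using g(2) by (metis fps_zero_nth zero_neq_one)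
  have sub: "subdegree ?g = 1"
    by (rule subdegreeI) (use g in auto)
  have "fps_nth (deg_log lam) 0 = 0"
    by (simp add: deg_log_def)
  hence "deg_log lam = 0 \<or> subdegree (deg_log lam) \<ge> 1"
    by (metis One_nat_def Suc_leI gr0I subdegree_eq_0_iff)
  hence "?g dvd deg_log lam"
    using g0 sub fps_dvd_iff dvd_0_right by metis
  thus ?thesis by simp
qed

lemma falling_fact_nat_less: "m < k \<Longrightarrow> falling_fact (real m) k = 0"
  unfolding falling_fact_def by (rule prod_zero) auto

lemma falling_fact_nat_self: "falling_fact (real m) m \<noteq> 0"
  by (auto simp: falling_fact_def)

lemma falling_fact_coeffs_unique:
  assumes eq: "\<And>x. (\<Sum>k=0..n. a k * falling_fact x k) = (\<Sum>k=0..n. b k * falling_fact x k)"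
    and "m \<le> n"
  shows "a m = b m"
  using \<open>m \<le> n\<close>
proof (induction m rule: less_induct)
  case (less m)
  have split: "(\<Sum>k=0..n. c k * falling_fact (real m) k) =
      (\<Sum>k<m. c k * falling_fact (real m) k) + c m * falling_fact (real m) m" for c :: "nat \<Rightarrow> real"
  proof -
    have "(\<Sum>k=0..n. c k * falling_fact (real m) k) = (\<Sum>k\<in>{..<Suc m}. c k * falling_fact (real m) k)"
      using less.prems by (intro sum.mono_neutral_right) (auto simp: falling_fact_nat_less)
    thus ?thesis by simp
  qed
  have "(\<Sum>k<m. a k * falling_fact (real m) k) = (\<Sum>k<m. b k * falling_fact (real m) k)"
    using less by (intro sum.cong) auto
  thus ?case
    using eq[of "real m"] falling_fact_nat_self[of m] by (simp add: split)
qed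

lemma deg_falling_fact_expansion:
  "\<exists>c. (\<forall>k>n. c k = 0) \<and> (\<forall>x. deg_falling_fact lam x n = (\<Sum>k=0..n. c k * falling_fact x k))"
proof (induction n)
  case 0
  show ?case
    by (rule exI[of _ "\<lambda>k. if k = 0 then 1 else 0"])
      (simp add: deg_falling_fact_def falling_fact_def)
next
  case (Suc n)
  then obtain c where c0: "\<And>k. k > n \<Longrightarrow> c k = 0"
    and c: "\<And>x. deg_falling_fact lam x n = (\<Sum>k=0..n. c k * falling_fact x k)"
    by blast
  define d where "d k = (if k = 0 then 0 else c (k - 1)) + (real k - real n * lam) * c k" for k
  have "deg_falling_fact lam x (Suc n) = (\<Sum>k=0..Suc n. d k * falling_fact x k)" for x
  proof -
    have step: "c k * falling_fact x k * (x - real n * lam) =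
        c k * falling_fact x (Suc k) + (real k - real n * lam) * c k * falling_fact x k" for k
      by (simp add: falling_fact_def algebra_simps)
    have "deg_falling_fact lam x (Suc n) = (\<Sum>k=0..n. c k * falling_fact x k * (x - real n * lam))"
      using c[of x] by (simp add: deg_falling_fact_def sum_distrib_right)
    also have "\<dots> = (\<Sum>k=0..n. c k * falling_fact x (Suc k)) +
        (\<Sum>k=0..n. (real k - real n * lam) * c k * falling_fact x k)"
      by (simp add: step sum.distrib)
    also have "(\<Sum>k=0..n. c k * falling_fact x (Suc k)) =
        (\<Sum>k=0..Suc n. (if k = 0 then 0 else c (k - 1)) * falling_fact x k)"
      by (simp only: sum.atLeast0_atMost_Suc_shift) simp
    also have "(\<Sum>k=0..n. (real k - real n * lam) * c k * falling_fact x k) =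
        (\<Sum>k=0..Suc n. (real k - real n * lam) * c k * falling_fact x k)"
      by (simp add: c0)
    finally show ?thesis
      by (simp only: d_def sum.distrib distrib_right)
  qed
  moreover have "\<forall>k>Suc n. d k = 0"
    by (simp add: d_def c0)
  ultimately show ?case by blast
qed

lemma deg_stirling2_ex1:
  "\<exists>!S. (\<forall>n k. k > n \<longrightarrow> S n k = 0) \<and>
     (\<forall>n x. deg_falling_fact lam x n = (\<Sum>k=0..n. S n k * falling_fact x k))"
proof (rule ex_ex1I)
  have "\<forall>n. \<exists>c. (\<forall>k>n. c k = 0) \<and>
      (\<forall>x. deg_falling_fact lam x n = (\<Sum>k=0..n. c k * falling_fact x k))"
    using deg_falling_fact_expansion by blast
  from choice[OF this] show "\<exists>S. (\<forall>n k. k > n \<longrightarrow> S n k = 0) \<and>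
      (\<forall>n x. deg_falling_fact lam x n = (\<Sum>k=0..n. S n k * falling_fact x k))"
    by blast
next
  fix S T :: "nat \<Rightarrow> nat \<Rightarrow> real"
  assume S: "(\<forall>n k. k > n \<longrightarrow> S n k = 0) \<and>
      (\<forall>n x. deg_falling_fact lam x n = (\<Sum>k=0..n. S n k * falling_fact x k))"
    and T: "(\<forall>n k. k > n \<longrightarrow> T n k = 0) \<and>
      (\<forall>n x. deg_falling_fact lam x n = (\<Sum>k=0..n. T n k * falling_fact x k))"
  have "S n k = T n k" for n k
  proof (cases "k \<le> n")
    case True
    have "(\<Sum>k=0..n. S n k * falling_fact x k) = (\<Sum>k=0..n. T n k * falling_fact x k)" for x
      using S T by metis
    from falling_fact_coeffs_unique[OF this True] show ?thesis .
  next
    case False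
    thus ?thesis using S T by simp
  qed
  thus "S = T" by blast
qed

lemma deg_stirling2_expansion:
  "deg_falling_fact lam x n = (\<Sum>k=0..n. deg_stirling2 lam n k * falling_fact x k)"
  using theI'[OF deg_stirling2_ex1[of lam]] unfolding deg_stirling2_def by blast

end

theory Submission
  imports Defs
begin

text \<open>Put \<open>u = e\<^sub>\<lambda>(t) - 1\<close>. Then \<open>(1 + \<lambda>t) u' = 1 + u\<close>, so substituting \<open>u\<close> into a series turns
  the operator \<open>(1 + t) d/dt\<close> into \<open>(1 + \<lambda>t) d/dt\<close>. Comparing differential equations, this gives
  \<open>e\<^sub>\<lambda>\<^sup>x(t) = (1 + u)\<^sup>x\<close> and \<open>log (1 + \<lambda>t) / \<lambda> = log (1 + u)\<close>. The coefficients of the binomial series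
  \<open>(1 + u)\<^sup>x\<close> identify \<open>u\<^sup>k / k!\<close> as the generating function of \<open>S\<^sub>2\<^sub>,\<^sub>\<lambda>(n, k)\<close>; the coefficients of
  \<open>log (1 + u) / u\<close> are then the first sum, and expanding \<open>u\<^sup>k = (e\<^sub>\<lambda>(t) - 1)\<^sup>k\<close> binomially, with
  \<open>e\<^sub>\<lambda>(t)\<^sup>j = e\<^sub>\<lambda>\<^sup>j(t)\<close>, gives the second.\<close>

unbundle fps_syntax

lemma fps_first_order_linear_ODE_unique:
  fixes a b c f g :: "'a :: {idom, ring_char_0} fps"
  assumes "a $ 0 \<noteq> 0"
    and f: "a * fps_deriv f = b * f + c" and g: "a * fps_deriv g = b * g + c"
    and init: "f $ 0 = g $ 0"
  shows "f = g"
proof (rule ccontr)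
  assume "f \<noteq> g"
  define h where "h = f - g"
  have "h \<noteq> 0" "h $ 0 = 0"
    using \<open>f \<noteq> g\<close> init by (simp_all add: h_def)
  then obtain d where d: "subdegree h = Suc d"
    by (metis not0_implies_Suc subdegree_eq_0_iff)
  have deriv_nth_nonzero: "fps_deriv h $ d \<noteq> 0"
    using nth_subdegree_nonzero [OF \<open>h \<noteq> 0\<close>] by (simp add: d del: of_nat_Suc)
  hence "subdegree (fps_deriv h) = d"
    using d by (intro subdegreeI) (simp_all add: nth_less_subdegree_zero)
  hence "(a * fps_deriv h) $ d = a $ 0 * fps_deriv h $ d"
    using \<open>a $ 0 \<noteq> 0\<close> nth_subdegree_mult [of a "fps_deriv h"] by simp
  moreover have "a * fps_deriv h = b * h"
    by (simp add: h_def f g right_diff_distrib)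
  moreover have "(b * h) $ d = 0"
    using d by (simp add: fps_mult_nth_outside_subdegrees)
  ultimately show False
    using deriv_nth_nonzero \<open>a $ 0 \<noteq> 0\<close> by simp
qed

lemma fps_minus_one_power_nth:
  fixes f :: "'a :: comm_ring_1 fps"
  shows "(f - 1) ^ k $ n = (\<Sum>j\<le>k. (-1) ^ (k + j) * of_nat (k choose j) * f ^ j $ n)"
proof -
  have "(f - 1) ^ k = (\<Sum>j\<le>k. of_nat (k choose j) * f ^ j * (-1) ^ (k - j))"
    using binomial_ring [of f "-1" k] by simp
  also have "\<dots> = (\<Sum>j\<le>k. fps_const ((-1) ^ (k + j)) * (of_nat (k choose j) * f ^ j))"
    by (intro sum.cong) (auto simp: minus_one_power_iff simp flip: fps_const_neg)
  finally show ?thesis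
    by (simp add: fps_sum_nth mult.assoc)
qed

lemma one_plus_fps_X_mult_fps_ln_deriv:
  "(1 + fps_X) * fps_deriv (fps_ln 1) = (1 :: 'a :: field_char_0 fps)"
  by (simp add: fps_ln_deriv inverse_mult_eq_1')

lemma one_plus_fps_X_mult_fps_binomial_deriv:
  fixes x :: "'a :: field_char_0"
  shows "(1 + fps_X) * fps_deriv (fps_binomial x) = fps_const x * fps_binomial x"
  by (simp add: fps_binomial_deriv fps_divide_unit inverse_mult_eq_1' mult.left_commute)

lemma falling_fact_conv_gbinomial: "falling_fact x k = fact k * (x gchoose k)"
  by (simp add: falling_fact_def gbinomial_mult_fact atLeast0LessThan)

lemma deg_exp_nth: "deg_exp lam x $ n = deg_falling_fact lam x n / fact n"
  by (simp add: deg_exp_def)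

lemma deg_exp_nth_0 [simp]: "deg_exp lam x $ 0 = 1"
  by (simp add: deg_exp_nth deg_falling_fact_def)

lemma deg_exp_deriv:
  "(1 + fps_const lam * fps_X) * fps_deriv (deg_exp lam x) = fps_const x * deg_exp lam x"
proof (rule fps_ext)
  fix n
  let ?e = "deg_exp lam x"
  have deriv_nth: "fps_deriv ?e $ n = (x - real n * lam) * ?e $ n"
    by (simp add: deg_exp_nth deg_falling_fact_def del: of_nat_Suc)
  have "((1 + fps_const lam * fps_X) * fps_deriv ?e) $ n =
      fps_deriv ?e $ n + lam * (fps_X * fps_deriv ?e) $ n"
    by (simp add: distrib_right mult.assoc del: fps_deriv_nth fps_X_mult_nth)
  also have "(fps_X * fps_deriv ?e) $ n = real n * ?e $ n"
    by (cases n) simp_all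
  also have "fps_deriv ?e $ n + lam * (real n * ?e $ n) = (fps_const x * ?e) $ n"
    unfolding deriv_nth by (simp add: algebra_simps)
  finally show "((1 + fps_const lam * fps_X) * fps_deriv ?e) $ n = (fps_const x * ?e) $ n" .
qed

lemma deg_log_deriv: "(1 + fps_const lam * fps_X) * fps_deriv (deg_log lam) = 1"
proof (cases "lam = 0")
  case False
  let ?c = "fps_const lam * fps_X"
  have "fps_deriv (deg_log lam) = fps_deriv (fps_ln 1) oo ?c"
    using False by (simp add: deg_log_def fps_compose_deriv mult.left_commute)
  moreover have "1 + ?c = (1 + fps_X) oo ?c"
    by (simp add: fps_compose_add_distrib)
  ultimately show ?thesis
    by (simp add: one_plus_fps_X_mult_fps_ln_deriv flip: fps_compose_mult_distrib)
qed (simp add: deg_log_def)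

abbreviation deg_expm1 :: "real \<Rightarrow> real fps" where
  "deg_expm1 lam \<equiv> deg_exp lam 1 - 1"

lemma fps_compose_deg_expm1_deriv:
  "(1 + fps_const lam * fps_X) * fps_deriv (F oo deg_expm1 lam) =
     ((1 + fps_X) * fps_deriv F) oo deg_expm1 lam"
proof -
  have "(1 + fps_const lam * fps_X) * fps_deriv (F oo deg_expm1 lam) =
      (fps_deriv F oo deg_expm1 lam) * ((1 + fps_const lam * fps_X) * fps_deriv (deg_exp lam 1))"
    by (simp add: fps_compose_deriv mult.left_commute)
  also have "\<dots> = (fps_deriv F oo deg_expm1 lam) * ((1 + fps_X) oo deg_expm1 lam)"
    by (simp add: deg_exp_deriv fps_compose_add_distrib)
  finally show ?thesis
    by (simp add: fps_compose_mult_distrib mult.commute)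
qed

lemma deg_exp_conv_fps_binomial: "deg_exp lam x = fps_binomial x oo deg_expm1 lam"
proof (rule fps_first_order_linear_ODE_unique)
  show "(1 + fps_const lam * fps_X) * fps_deriv (deg_exp lam x) = fps_const x * deg_exp lam x + 0"
    by (simp add: deg_exp_deriv)
  show "(1 + fps_const lam * fps_X) * fps_deriv (fps_binomial x oo deg_expm1 lam) =
      fps_const x * (fps_binomial x oo deg_expm1 lam) + 0"
    by (simp add: fps_compose_deg_expm1_deriv one_plus_fps_X_mult_fps_binomial_deriv
        fps_const_mult_apply_left)
qed simp_all

lemma deg_log_conv_fps_ln: "deg_log lam = fps_ln 1 oo deg_expm1 lam"
proof (rule fps_first_order_linear_ODE_unique)
  show "(1 + fps_const lam * fps_X) * fps_deriv (deg_log lam) = 0 * deg_log lam + 1"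
    by (simp add: deg_log_deriv)
  show "(1 + fps_const lam * fps_X) * fps_deriv (fps_ln 1 oo deg_expm1 lam) =
      0 * (fps_ln 1 oo deg_expm1 lam) + 1"
    by (simp add: fps_compose_deg_expm1_deriv one_plus_fps_X_mult_fps_ln_deriv)
qed (simp_all add: deg_log_def)

lemma deg_exp_0_right: "deg_exp lam 0 = 1"
  by (simp add: deg_exp_conv_fps_binomial [of lam 0])

lemma deg_exp_power: "deg_exp lam 1 ^ j = deg_exp lam (real j)"
proof -
  have "deg_exp lam (real j) = (1 + fps_X) ^ j oo deg_expm1 lam"
    by (simp add: deg_exp_conv_fps_binomial [of lam "real j"] fps_binomial_of_nat)
  also have "\<dots> = deg_exp lam 1 ^ j"
    by (simp add: fps_compose_add_distrib flip: fps_compose_power)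
  finally show ?thesis ..
qed

lemma deg_log_divide_deg_expm1:
  "deg_log lam / deg_expm1 lam = fps_shift 1 (fps_ln 1) oo deg_expm1 lam"
proof -
  have "fps_ln 1 = fps_shift 1 (fps_ln 1) * (fps_X :: real fps)"
    by (rule fps_ext) simp
  hence "deg_log lam = (fps_shift 1 (fps_ln 1) * fps_X) oo deg_expm1 lam"
    by (simp only: deg_log_conv_fps_ln)
  also have "\<dots> = (fps_shift 1 (fps_ln 1) oo deg_expm1 lam) * deg_expm1 lam"
    by (simp add: fps_compose_mult_distrib)
  finally have "deg_log lam = (fps_shift 1 (fps_ln 1) oo deg_expm1 lam) * deg_expm1 lam" .
  moreover have "deg_expm1 lam \<noteq> 0"
  proof -
    have "deg_expm1 lam $ 1 \<noteq> 0"
      by (simp add: deg_exp_nth deg_falling_fact_def)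
    thus ?thesis
      by (metis fps_zero_nth)
  qed
  ultimately show ?thesis
    by simp
qed

lemma deg_stirling2_conv_deg_expm1_power:
  "deg_stirling2 lam n k = fact n / fact k * (deg_expm1 lam ^ k $ n)"
proof -
  define S where "S n k = fact n / fact k * (deg_expm1 lam ^ k $ n)" for n k
  have "S n k = 0" if "k > n" for n k
    using that by (simp add: S_def startsby_zero_power_prefix)
  moreover have "deg_falling_fact lam x n = (\<Sum>k=0..n. S n k * falling_fact x k)" for n x
  proof -
    have "deg_falling_fact lam x n = fact n * (fps_binomial x oo deg_expm1 lam) $ n"
      by (simp add: deg_exp_nth flip: deg_exp_conv_fps_binomial)
    also have "\<dots> = (\<Sum>k=0..n. S n k * falling_fact x k)"
      by (simp add: fps_compose_nth S_def falling_fact_conv_gbinomial sum_distrib_left mult_ac)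
    finally show ?thesis .
  qed
  ultimately have "deg_stirling2 lam = S"
    unfolding deg_stirling2_def by (intro the1_equality deg_stirling2_ex1) blast
  thus ?thesis
    by (simp add: S_def)
qed

lemma fps_compose_deg_expm1_nth:
  "fact n * (F oo deg_expm1 lam) $ n = (\<Sum>k=0..n. F $ k * fact k * deg_stirling2 lam n k)"
  by (simp add: fps_compose_nth deg_stirling2_conv_deg_expm1_power sum_distrib_left mult_ac)

lemma fact_mult_deg_stirling2_conv_sum:
  "fact k * deg_stirling2 lam n k =
     (\<Sum>j=0..k. (-1) ^ (k + j) * real (k choose j) * deg_falling_fact lam (real j) n)"
  by (simp add: deg_stirling2_conv_deg_expm1_power fps_minus_one_power_nth deg_exp_power
      deg_exp_nth sum_distrib_left atLeast0AtMost)

lemma full_deg_bernoulli_conv_deg_stirling2: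
  "full_deg_bernoulli lam n =
     (\<Sum>k=0..n. (-1) ^ k / (real k + 1) * fact k * deg_stirling2 lam n k)"
proof -
  have "full_deg_bernoulli lam n = fact n * (fps_shift 1 (fps_ln 1) oo deg_expm1 lam) $ n"
    by (simp only: full_deg_bernoulli_def full_deg_bernoulli_poly_def deg_exp_0_right
        deg_log_divide_deg_expm1 mult_1_right)
  also have "\<dots> = (\<Sum>k=0..n. (-1) ^ k / (real k + 1) * fact k * deg_stirling2 lam n k)"
    by (simp add: fps_compose_deg_expm1_nth fps_ln_nth add.commute)
  finally show ?thesis .
qed

theorem theorem1:
  fixes lam :: real and n :: nat
  shows "full_deg_bernoulli lam n =
           (\<Sum>k=0..n. (-1) ^ k / (real k + 1) * fact k * deg_stirling2 lam n k) \<and>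
         (\<Sum>k=0..n. (-1) ^ k / (real k + 1) * fact k * deg_stirling2 lam n k) =
           (\<Sum>k=0..n. 1 / (real k + 1) *
             (\<Sum>j=0..k. real (k choose j) * (-1) ^ j * deg_falling_fact lam (real j) n))"
proof
  show "full_deg_bernoulli lam n =
      (\<Sum>k=0..n. (-1) ^ k / (real k + 1) * fact k * deg_stirling2 lam n k)"
    by (rule full_deg_bernoulli_conv_deg_stirling2)
  have signed_deg_stirling2: "(-1) ^ k * fact k * deg_stirling2 lam n k =
      (\<Sum>j=0..k. real (k choose j) * (-1) ^ j * deg_falling_fact lam (real j) n)" for k
    unfolding mult.assoc fact_mult_deg_stirling2_conv_sum
    by (simp add: sum_distrib_left power_add mult_ac)
  show "(\<Sum>k=0..n. (-1) ^ k / (real k + 1) * fact k * deg_stirling2 lam n k) =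
      (\<Sum>k=0..n. 1 / (real k + 1) *
        (\<Sum>j=0..k. real (k choose j) * (-1) ^ j * deg_falling_fact lam (real j) n))"
    by (simp flip: signed_deg_stirling2)
qed

end
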